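(* The following bounded trajectory problem is decidable. INSTANCE: a finite set of nonnegative integer matrices $\mathcal M=\{A_1,\ldots,A_m\}\subset\mathbb Z^{n\times n}$ and a finite set of nonnegative integer vectors $V=\{u_1,\ldots,u_p\}\subset\mathbb Z^n$. PROBLEM: determine whether there exist a sequence $(i_t)_{t=1}^\infty$ with $i_t\in\{1,\ldots,m\}$ and an initial vector $v_0\in V$ such that the sequence of vectors determined by the recurrence $v_t=A_{i_t}v_{t-1}$, $t=1,2,\ldots$, is bounded.
   Context: Nonnegative means entrywise nonnegative. Decidable means that there is an algorithm which halts on every instance and answers correctly. *)

theory Defs
  imports "HOL-Library.Nat_Bijection" "Jordan_Normal_Form.Matrix"
begin

section \<open>Partial recursive functions\<close>

text \<open>Algorithms are programs for Kleene's partial recursive functions on natural numbers.\<close>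

datatype recf =
    Zero
  | Succ
  | Proj nat
  | Comp recf "recf list"
  | PrimRec recf recf
  | Mu recf

text \<open>\<open>halts_with f xs y\<close>: the program \<open>f\<close>, run on the arguments \<open>xs\<close>, halts with output \<open>y\<close>.
  Arguments are numbered from 0. In a primitive recursion the recursion argument comes first, and the
  step program receives its predecessor, the value computed for the predecessor, and the parameters,
  in this order. \<open>Mu f\<close> searches for the least \<open>y\<close> such that \<open>f\<close> yields 0 on \<open>y # xs\<close>, and
  \<open>f\<close> has to halt on all smaller values. Arities are not tracked: surplus arguments are
  ignored, and a program that has to access a missing argument does not halt.\<close>

inductive halts_with :: "recf \<Rightarrow> nat list \<Rightarrow> nat \<Rightarrow> bool" where
  zero: "halts_with Zero xs 0"
| succ: "halts_with Succ (x # xs) (Suc x)"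
| proj: "i < length xs \<Longrightarrow> halts_with (Proj i) xs (xs ! i)"
| comp: "list_all2 (\<lambda>g y. halts_with g xs y) gs ys \<Longrightarrow> halts_with f ys z
    \<Longrightarrow> halts_with (Comp f gs) xs z"
| primrec_0: "halts_with f xs y \<Longrightarrow> halts_with (PrimRec f g) (0 # xs) y"
| primrec_Suc: "halts_with (PrimRec f g) (n # xs) y \<Longrightarrow> halts_with g (n # y # xs) z
    \<Longrightarrow> halts_with (PrimRec f g) (Suc n # xs) z"
| mu: "halts_with f (y # xs) 0 \<Longrightarrow> (\<forall>k<y. \<exists>z. halts_with f (k # xs) (Suc z))
    \<Longrightarrow> halts_with (Mu f) xs y"

inductive_cases halts_with_elims:
  "halts_with Zero xs y"
  "halts_with Succ xs y"
  "halts_with (Proj i) xs y"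
  "halts_with (Comp f gs) xs y"
  "halts_with (PrimRec f g) (0 # xs) y"
  "halts_with (PrimRec f g) (Suc n # xs) y"
  "halts_with (Mu f) xs y"

lemma halts_with_unique:
  "halts_with f xs y \<Longrightarrow> halts_with f xs y' \<Longrightarrow> y = y'"
proof (induction arbitrary: y' rule: halts_with.induct)
  case (zero xs)
  then show ?case by (rule halts_with_elims(1)) simp
next
  case (succ x xs)
  then show ?case by (rule halts_with_elims(2)) simp
next
  case (proj i xs)
  from proj.prems show ?case by (rule halts_with_elims(3)) simp
next
  case (comp xs gs ys f z)
  from comp.prems obtain ys' where ys': "list_all2 (\<lambda>g y. halts_with g xs y) gs ys'"
    and f: "halts_with f ys' y'"
    by (rule halts_with_elims(4))
  have "ys = ys'"
  proof (rule nth_equalityI)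
    show "length ys = length ys'"
      using comp.IH(1) ys' by (simp add: list_all2_conv_all_nth)
  next
    fix i assume "i < length ys"
    with comp.IH(1) ys' show "ys ! i = ys' ! i"
      unfolding list_all2_conv_all_nth by metis
  qed
  with f comp.IH(2) show ?case by blast
next
  case (primrec_0 f xs y g)
  from primrec_0.prems have "halts_with f xs y'" by (rule halts_with_elims(5))
  then show ?case by (rule primrec_0.IH)
next
  case (primrec_Suc f g n xs y z)
  from primrec_Suc.prems obtain w where w: "halts_with (PrimRec f g) (n # xs) w"
    and g: "halts_with g (n # w # xs) y'"
    by (rule halts_with_elims(6))
  from primrec_Suc.IH(1)[OF w] g have "halts_with g (n # y # xs) y'" by simp
  then show ?case by (rule primrec_Suc.IH(2))
next
  case (mu f y xs)
  from mu.prems have a: "halts_with f (y' # xs) 0"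
    and b: "\<forall>k<y'. \<exists>z. halts_with f (k # xs) (Suc z)"
    by (rule halts_with_elims(7); blast)+
  have "\<not> y < y'"
  proof
    assume "y < y'"
    with b obtain z where "halts_with f (y # xs) (Suc z)" by blast
    from mu.IH(1)[OF this] show False by simp
  qed
  moreover have "\<not> y' < y"
  proof
    assume "y' < y"
    with mu.IH(2) a obtain z where "0 = Suc z" by metis
    then show False by simp
  qed
  ultimately show ?case by simp
qed

definition decidable :: "('i \<Rightarrow> nat) \<Rightarrow> 'i set \<Rightarrow> ('i \<Rightarrow> bool) \<Rightarrow> bool" where
  "decidable code I Q \<longleftrightarrow>
     (\<exists>f. \<forall>x\<in>I. halts_with f [code x] (if Q x then 1 else 0))"


section \<open>The bounded trajectory problem\<close>

text \<open>An instance lists the dimension, the matrices and the vectors. The finite sets are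
  given by enumerations, in any order and possibly with repetitions.\<close>

type_synonym inst = "nat \<times> int mat list \<times> int vec list"

definition nonneg_int_mats :: "nat \<Rightarrow> int mat set" where
  "nonneg_int_mats n = {A \<in> carrier_mat n n. \<forall>i<n. \<forall>j<n. 0 \<le> A $$ (i, j)}"

definition nonneg_int_vecs :: "nat \<Rightarrow> int vec set" where
  "nonneg_int_vecs n = {u \<in> carrier_vec n. \<forall>i<n. 0 \<le> u $ i}"

definition instances :: "inst set" where
  "instances = {(n, As, us). set As \<subseteq> nonneg_int_mats n \<and> set us \<subseteq> nonneg_int_vecs n}"

definition bounded_vecs :: "nat \<Rightarrow> (nat \<Rightarrow> int vec) \<Rightarrow> bool" where
  "bounded_vecs n v \<longleftrightarrow> (\<exists>B. \<forall>t. \<forall>j<n. \<bar>v t $ j\<bar> \<le> B)"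

text \<open>Here \<open>s t\<close> is the 0-based index of the matrix taking \<open>v t\<close> to \<open>v (Suc t)\<close>.\<close>

fun has_bounded_trajectory :: "inst \<Rightarrow> bool" where
  "has_bounded_trajectory (n, As, us) \<longleftrightarrow>
     (\<exists>(s :: nat \<Rightarrow> nat) (v :: nat \<Rightarrow> int vec).
        (\<forall>t. s t < length As) \<and> v 0 \<in> set us \<and>
        (\<forall>t. v (Suc t) = (As ! s t) *\<^sub>v v t) \<and> bounded_vecs n v)"

text \<open>Entries are nonnegative on all instances, so \<open>nat\<close> loses no information.\<close>

definition code_vec :: "int vec \<Rightarrow> nat" where
  "code_vec u = list_encode (map nat (list_of_vec u))"

definition code_mat :: "int mat \<Rightarrow> nat" where
  "code_mat A = list_encode (map (\<lambda>r. list_encode (map nat r)) (mat_to_list A))"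

fun code_inst :: "inst \<Rightarrow> nat" where
  "code_inst (n, As, us) =
     prod_encode (n, prod_encode (list_encode (map code_mat As), list_encode (map code_vec us)))"

lemma inj_on_code_vec: "inj_on code_vec (nonneg_int_vecs n)"
proof (rule inj_onI)
  fix u w assume u: "u \<in> nonneg_int_vecs n" and w: "w \<in> nonneg_int_vecs n"
    and "code_vec u = code_vec w"
  then have eq: "map nat (list_of_vec u) = map nat (list_of_vec w)"
    by (simp add: code_vec_def list_encode_eq)
  show "u = w"
  proof (rule eq_vecI)
    fix i assume "i < dim_vec w"
    with u w have i: "i < n" "dim_vec u = n" "dim_vec w = n"
      by (auto simp: nonneg_int_vecs_def)
    have "map nat (list_of_vec u) ! i = map nat (list_of_vec w) ! i" using eq by simp
    with i have "nat (u $ i) = nat (w $ i)" by simp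
    with u w i show "u $ i = w $ i" by (simp add: nonneg_int_vecs_def eq_nat_nat_iff)
  qed (use u w in \<open>auto simp: nonneg_int_vecs_def\<close>)
qed

lemma inj_on_code_mat: "inj_on code_mat (nonneg_int_mats n)"
proof (rule inj_onI)
  fix A B assume A: "A \<in> nonneg_int_mats n" and B: "B \<in> nonneg_int_mats n"
    and "code_mat A = code_mat B"
  then have eq: "map (\<lambda>r. list_encode (map nat r)) (mat_to_list A) =
      map (\<lambda>r. list_encode (map nat r)) (mat_to_list B)"
    by (simp add: code_mat_def list_encode_eq)
  show "A = B"
  proof (rule eq_matI)
    fix i j assume "i < dim_row B" "j < dim_col B"
    with A B have d: "i < n" "j < n" "dim_row A = n" "dim_row B = n" "dim_col A = n" "dim_col B = n"
      by (auto simp: nonneg_int_mats_def)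
    have "map (\<lambda>r. list_encode (map nat r)) (mat_to_list A) ! i =
        map (\<lambda>r. list_encode (map nat r)) (mat_to_list B) ! i"
      using eq by simp
    with d have "map nat (map (\<lambda>j. A $$ (i, j)) [0..<n]) = map nat (map (\<lambda>j. B $$ (i, j)) [0..<n])"
      by (simp add: mat_to_list_def list_encode_eq)
    with d have "nat (A $$ (i, j)) = nat (B $$ (i, j))" by simp
    with A B d show "A $$ (i, j) = B $$ (i, j)" by (simp add: nonneg_int_mats_def eq_nat_nat_iff)
  qed (use A B in \<open>auto simp: nonneg_int_mats_def\<close>)
qed

lemma inj_on_code_inst: "inj_on code_inst instances"
proof (rule inj_onI)
  fix x y assume x: "x \<in> instances" and y: "y \<in> instances" and eq: "code_inst x = code_inst y"
  obtain n As us where x': "x = (n, As, us)" by (cases x)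
  obtain m Bs ws where y': "y = (m, Bs, ws)" by (cases y)
  have e: "m = n" "map code_mat As = map code_mat Bs" "map code_vec us = map code_vec ws"
    using eq by (auto simp: x' y' list_encode_eq)
  have s: "set As \<union> set Bs \<subseteq> nonneg_int_mats n" "set us \<union> set ws \<subseteq> nonneg_int_vecs n"
    using x y e(1) by (auto simp: x' y' instances_def)
  have "As = Bs"
    using e(2) inj_on_subset[OF inj_on_code_mat s(1)] by (rule map_inj_on)
  moreover have "us = ws"
    using e(3) inj_on_subset[OF inj_on_code_vec s(2)] by (rule map_inj_on)
  ultimately show "x = y" using e(1) by (simp add: x' y')
qed

end

theory Submission
  imports Defs
begin

text \<open>A bounded trajectory of nonnegative integer vectors takes finitely many values, so it visits some
  vector twice; conversely a trajectory that repeats a vector can be continued by running the same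
  loop forever. Hence the question is whether some trajectory repeats a vector, and the problem is
  decidable once the length of a shortest repetition is bounded by a computable function of the
  instance. The bound is \<open>3 ^ (n * n + 1)\<close>, for any matrices and vectors of dimension \<open>n\<close>.

  The bound comes from replacing matrix entries by their minimum with 2, which leaves \<open>3 ^ (n * n)\<close>
  matrices and is compatible with products. By the pigeonhole principle, every product is equal, after
  truncation, to a product of at most \<open>3 ^ (n * n)\<close> factors (\<open>short_word_mat\<close>). Now let
  \<open>v = P u\<close> and \<open>Q v = v\<close> with products \<open>P\<close>, \<open>Q\<close>. Some power \<open>R\<close> of \<open>Q\<close> is idempotent after truncation.
  On the support of \<open>v\<close>, the equation \<open>R v = v\<close> then forces a very rigid shape: every column of \<open>R\<close>
  that is not zero belongs to an index whose row is that of the identity matrix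
  (\<open>absorbing_of_fixed_vector\<close>). This shape can be read off the truncation of \<open>R\<close> and the
  support of \<open>v\<close>, and it implies \<open>R R x = R x\<close> for all \<open>x\<close> with the same support
  (\<open>absorbing_idempotent\<close>). So \<open>P\<close> and \<open>R\<close> may be replaced by short products \<open>P'\<close>, \<open>Q'\<close> with the same
  truncations: although \<open>P' u\<close> need not be fixed by \<open>Q'\<close>, the vectors \<open>Q' P' u\<close> and \<open>Q' Q' P' u\<close>
  agree (\<open>short_loop\<close>).

  The algorithm searches through all initial vectors and all sequences of matrices up to this length
  for a repetition. A sequence of matrices is represented by a single number, whose digits in base \<open>m\<close>
  are the indices of the matrices, so the search consists of bounded quantifiers over numbers. A small
  calculus of computable functions, closed under primitive recursion, bounded sums and bounded
  quantifiers, turns its description into a program.\<close>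

section \<open>Truncating matrices\<close>

text \<open>The cutoff 2 keeps the difference between 0, 1 and larger entries. Under
  iteration, a diagonal entry of at least 2 makes every nonnegative vector grow whose support contains
  its index, whereas 1 need not.\<close>

definition trunc :: "nat \<Rightarrow> int mat \<Rightarrow> nat \<times> nat \<Rightarrow> int" where
  "trunc n X = (\<lambda>(i, j)\<in>{..<n} \<times> {..<n}. min 2 (X $$ (i, j)))"

lemma trunc_eq_iff:
  "trunc n X = trunc n Y \<longleftrightarrow>
    (\<forall>i<n. \<forall>j<n. min 2 (X $$ (i, j)) = min 2 (Y $$ (i, j)))"
proof
  assume eq: "trunc n X = trunc n Y"
  show "\<forall>i<n. \<forall>j<n. min 2 (X $$ (i, j)) = min 2 (Y $$ (i, j))"
  proof (intro allI impI)
    fix i j assume "i < n" "j < n"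
    with fun_cong[OF eq, of "(i, j)"] show "min 2 (X $$ (i, j)) = min 2 (Y $$ (i, j))"
      by (simp add: trunc_def)
  qed
qed (auto simp: trunc_def fun_eq_iff restrict_def)

definition trunc_mats :: "nat \<Rightarrow> (nat \<times> nat \<Rightarrow> int) set" where
  "trunc_mats n = ({..<n} \<times> {..<n}) \<rightarrow>\<^sub>E {0..2}"

lemma trunc_in_trunc_mats: "X \<in> nonneg_int_mats n \<Longrightarrow> trunc n X \<in> trunc_mats n"
  by (auto simp: trunc_def trunc_mats_def nonneg_int_mats_def)

lemma finite_trunc_mats: "finite (trunc_mats n)"
  by (simp add: trunc_mats_def finite_PiE)

lemma card_trunc_mats: "card (trunc_mats n) = 3 ^ (n * n)"
  by (simp add: trunc_mats_def card_PiE)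

lemma mult_mat_entry:
  assumes "A \<in> carrier_mat n n" "B \<in> carrier_mat n n" "i < n" "j < n"
  shows "(A * B) $$ (i, j) = (\<Sum>k<n. A $$ (i, k) * B $$ (k, j))"
  using assms by (auto simp: scalar_prod_def lessThan_atLeast0 intro!: sum.cong)

lemma mult_vec_entry:
  assumes "A \<in> carrier_mat n n" "v \<in> carrier_vec n" "i < n"
  shows "(A *\<^sub>v v) $ i = (\<Sum>k<n. A $$ (i, k) * v $ k)"
  using assms by (auto simp: scalar_prod_def lessThan_atLeast0 intro!: sum.cong)

lemma nonneg_mult_mat:
  assumes "A \<in> nonneg_int_mats n" "B \<in> nonneg_int_mats n"
  shows "A * B \<in> nonneg_int_mats n"
proof -
  have "0 \<le> (A * B) $$ (i, j)" if "i < n" "j < n" for i j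
    using assms that
    by (subst mult_mat_entry[where n = n]) (auto simp: nonneg_int_mats_def intro!: sum_nonneg)
  with assms show ?thesis by (auto simp: nonneg_int_mats_def)
qed

lemma nonneg_one_mat: "1\<^sub>m n \<in> nonneg_int_mats n"
  by (auto simp: nonneg_int_mats_def)

lemma nonneg_mult_vec:
  assumes "A \<in> nonneg_int_mats n" "v \<in> nonneg_int_vecs n"
  shows "A *\<^sub>v v \<in> nonneg_int_vecs n"
proof -
  have "0 \<le> (A *\<^sub>v v) $ i" if "i < n" for i
    using assms that
    by (subst mult_vec_entry[where n = n])
      (auto simp: nonneg_int_mats_def nonneg_int_vecs_def intro!: sum_nonneg)
  with assms show ?thesis by (auto simp: nonneg_int_mats_def nonneg_int_vecs_def)
qed

lemma min_2_mult_cong: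
  fixes x y a :: int
  assumes "min 2 x = min 2 y" "0 \<le> a"
  shows "min 2 (x * a) = min 2 (y * a)"
proof (cases "x = y \<or> a = 0")
  case False
  then have "2 \<le> x" "2 \<le> y" "1 \<le> a" using assms by auto
  then have "2 * 1 \<le> x * a" "2 * 1 \<le> y * a" by (intro mult_mono; simp)+
  then show ?thesis by simp
qed auto

lemma min_2_sum_cong:
  fixes f g :: "'a \<Rightarrow> int"
  assumes "\<And>k. k \<in> K \<Longrightarrow> min 2 (f k) = min 2 (g k)" "\<And>k. k \<in> K \<Longrightarrow> 0 \<le> f k"
    "\<And>k. k \<in> K \<Longrightarrow> 0 \<le> g k"
  shows "min 2 (sum f K) = min 2 (sum g K)"
  using assms
proof (induction K rule: infinite_finite_induct)
  case (insert k K)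
  have "0 \<le> sum f K" "0 \<le> sum g K" using insert.prems by (auto intro!: sum_nonneg)
  moreover have "min 2 (sum f K) = min 2 (sum g K)" using insert by auto
  moreover have "min 2 (f k) = min 2 (g k)" "0 \<le> f k" "0 \<le> g k" using insert.prems by auto
  ultimately have "min 2 (f k + sum f K) = min 2 (g k + sum g K)" by linarith
  then show ?case using insert.hyps by simp
qed auto

lemma trunc_mult_right_cong:
  assumes "X \<in> nonneg_int_mats n" "Y \<in> nonneg_int_mats n" "A \<in> nonneg_int_mats n"
    and "trunc n X = trunc n Y"
  shows "trunc n (X * A) = trunc n (Y * A)"
  unfolding trunc_eq_iff
proof (intro allI impI)
  fix i j assume "i < n" "j < n"
  have "min 2 (\<Sum>k<n. X $$ (i, k) * A $$ (k, j)) = min 2 (\<Sum>k<n. Y $$ (i, k) * A $$ (k, j))"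
    using assms \<open>i < n\<close> \<open>j < n\<close>
    by (intro min_2_sum_cong min_2_mult_cong) (auto simp: trunc_eq_iff nonneg_int_mats_def)
  moreover have "X \<in> carrier_mat n n" "Y \<in> carrier_mat n n" "A \<in> carrier_mat n n"
    using assms by (auto simp: nonneg_int_mats_def)
  ultimately show "min 2 ((X * A) $$ (i, j)) = min 2 ((Y * A) $$ (i, j))"
    using mult_mat_entry[of X n A i j] mult_mat_entry[of Y n A i j] \<open>i < n\<close> \<open>j < n\<close> by simp
qed

section \<open>Words of matrices\<close>

text \<open>The head of the list is the matrix that is applied first, so it is the rightmost factor.\<close>

fun word_mat :: "nat \<Rightarrow> int mat list \<Rightarrow> int mat" where
  "word_mat n [] = 1\<^sub>m n"
| "word_mat n (A # w) = word_mat n w * A"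

lemma word_mat_nonneg: "set w \<subseteq> nonneg_int_mats n \<Longrightarrow> word_mat n w \<in> nonneg_int_mats n"
  by (induction w) (auto intro: nonneg_one_mat nonneg_mult_mat)

lemma word_mat_carrier: "set w \<subseteq> nonneg_int_mats n \<Longrightarrow> word_mat n w \<in> carrier_mat n n"
  using word_mat_nonneg by (auto simp: nonneg_int_mats_def)

lemma word_mat_append:
  assumes "set w \<subseteq> nonneg_int_mats n" "set w' \<subseteq> nonneg_int_mats n"
  shows "word_mat n (w @ w') = word_mat n w' * word_mat n w"
  using assms
proof (induction w)
  case Nil
  then show ?case using word_mat_carrier[of w' n] by simp
next
  case (Cons A w)
  then have "A \<in> carrier_mat n n" by (auto simp: nonneg_int_mats_def)
  with Cons show ?case
    using word_mat_carrier[of w n] word_mat_carrier[of w' n] by simp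
qed

text \<open>Suffixes of a shortest nonempty word with a prescribed value take pairwise different values, since
  otherwise the piece between two suffixes with equal values could be cut out. Empty suffixes are left
  out of the comparison, so that cutting never turns a nonempty word into the empty one.\<close>

lemma short_word:
  fixes f :: "'a list \<Rightarrow> 'b"
  assumes step: "\<And>a w w'. set (a # w @ w') \<subseteq> A \<Longrightarrow> f w = f w' \<Longrightarrow> f (a # w) = f (a # w')"
    and fin: "finite K" and K: "\<And>w. set w \<subseteq> A \<Longrightarrow> f w \<in> K"
    and w: "set w \<subseteq> A"
  obtains w' where "set w' \<subseteq> A" "f w' = f w" "length w' \<le> card K" "w' = [] \<longleftrightarrow> w = []"
proof -
  define good where "good w' \<longleftrightarrow> set w' \<subseteq> A \<and> f w' = f w \<and> (w' = [] \<longleftrightarrow> w = [])" for w'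
  have "good w" using w by (simp add: good_def)
  then obtain w' where w': "good w'" and least: "\<And>y. good y \<Longrightarrow> length w' \<le> length y"
    using ex_has_least_nat[of good w length] by blast
  have cong: "f (x @ y) = f (x @ z)" if "set (x @ y @ z) \<subseteq> A" "f y = f z" for x y z
    using that by (induction x) (auto intro!: step)
  have distinct: "f (drop i w') \<noteq> f (drop j w')" if "i < j" "j < length w'" for i j
  proof
    assume eq: "f (drop i w') = f (drop j w')"
    let ?y = "take i w' @ drop j w'"
    have "set (take i w' @ drop j w' @ drop i w') \<subseteq> A"
      using w' by (auto simp: good_def dest: in_set_takeD in_set_dropD)
    then have "f ?y = f (take i w' @ drop i w')" using eq by (intro cong) auto
    then have "good ?y" using w' that by (auto simp: good_def dest: in_set_takeD in_set_dropD)
    from least[OF this] that show False by simp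
  qed
  have "inj_on (\<lambda>i. f (drop i w')) {..<length w'}"
    by (rule inj_onI) (metis distinct lessThan_iff linorder_neqE_nat)
  moreover have "(\<lambda>i. f (drop i w')) ` {..<length w'} \<subseteq> K"
    using w' by (auto simp: good_def intro!: K dest: in_set_dropD)
  ultimately have "length w' \<le> card K" using card_inj_on_le[OF _ _ fin] by fastforce
  with w' that show thesis by (auto simp: good_def)
qed

lemma short_word_mat:
  assumes "set w \<subseteq> M" "M \<subseteq> nonneg_int_mats n"
  obtains w' where "set w' \<subseteq> M" "trunc n (word_mat n w') = trunc n (word_mat n w)"
    "length w' \<le> 3 ^ (n * n)" "w' = [] \<longleftrightarrow> w = []"
proof (rule short_word[of M "\<lambda>w. trunc n (word_mat n w)" "trunc_mats n" w])
  fix a w w'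
  assume "set (a # w @ w') \<subseteq> M" "trunc n (word_mat n w) = trunc n (word_mat n w')"
  then show "trunc n (word_mat n (a # w)) = trunc n (word_mat n (a # w'))"
    using assms(2) by (auto intro!: trunc_mult_right_cong word_mat_nonneg)
next
  fix w assume "set w \<subseteq> M"
  with assms(2) show "trunc n (word_mat n w) \<in> trunc_mats n"
    by (intro trunc_in_trunc_mats word_mat_nonneg) auto
qed (use assms that in \<open>auto simp: finite_trunc_mats card_trunc_mats\<close>)

section \<open>Idempotent powers\<close>

text \<open>In a finite semigroup some power of every element is idempotent. Here \<open>f k\<close> stands for the
  \<open>k\<close>-th power, of which only the transition to the next power matters.\<close>

lemma idempotent_index:
  fixes f :: "nat \<Rightarrow> 'b"
  assumes fin: "finite (range f)" and step: "\<And>a b. f a = f b \<Longrightarrow> f (Suc a) = f (Suc b)"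
  obtains k where "0 < k" "f (k + k) = f k"
proof -
  have shift: "f (a + c) = f (b + c)" if "f a = f b" for a b c
    using that by (induction c) (auto intro: step)
  obtain a b where ab: "a < b" "f a = f b"
    using fin by (metis finite_imageD infinite_UNIV_nat injI linorder_neqE_nat)
  then obtain d where d: "b = a + d" "0 < d" by (metis less_imp_add_positive)
  have period: "f (a + e + t * d) = f (a + e)" for e t
  proof (induction t)
    case (Suc t)
    have "f (b + (e + t * d)) = f (a + (e + t * d))"
      using ab(2) by (intro shift) simp
    then show ?case using d Suc by (simp add: algebra_simps)
  qed simp
  \<comment> \<open>A multiple of the period \<open>d\<close> that lies beyond the preperiod \<open>a\<close> is a suitable exponent.\<close>
  have "a \<le> Suc a * d" using d(2) by (cases d) auto
  then obtain e where e: "Suc a * d = a + e" using le_Suc_ex by blast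
  show thesis
  proof (rule that[of "Suc a * d"])
    show "f (Suc a * d + Suc a * d) = f (Suc a * d)" using period[of e "Suc a"] unfolding e .
  qed (use d in simp)
qed

text \<open>The hypothesis says that \<open>r\<close> is an idempotent relation: it is transitive, and every pair has an
  intermediate point. If no point between \<open>i\<close> and \<open>j\<close> had a loop, then \<open>r\<close> would be a strict
  order on the finite set of these points, and a point between \<open>i\<close> and a minimal one of them would
  contradict minimality.\<close>

lemma idempotent_relation_through_loop:
  fixes r :: "'a \<Rightarrow> 'a \<Rightarrow> bool"
  assumes "finite V" and dense: "\<And>i j. i \<in> V \<Longrightarrow> j \<in> V \<Longrightarrow> r i j \<longleftrightarrow> (\<exists>l\<in>V. r i l \<and> r l j)"
    and "i \<in> V" "j \<in> V" "r i j"
  obtains l where "l \<in> V" "r i l" "r l l" "r l j"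
proof (rule ccontr)
  assume "\<not> thesis"
  with that have no_loop: "\<not> r l l" if "l \<in> V" "r i l" "r l j" for l using that by blast
  define X where "X = {l \<in> V. r i l \<and> r l j}"
  have tr: "r x z" if "x \<in> V" "y \<in> V" "z \<in> V" "r x y" "r y z" for x y z
    using dense[OF that(1,3)] that(2,4,5) by blast
  have mid: "\<exists>l\<in>V. r x l \<and> r l z" if "x \<in> V" "z \<in> V" "r x z" for x z
    using dense[OF that(1,2)] that(3) by blast
  have fin: "finite X" using assms(1) by (simp add: X_def)
  have ne: "X \<noteq> {}" using mid[OF assms(3-5)] by (auto simp: X_def)
  have irr: "\<not> r x x" if "x \<in> X" for x
    using no_loop[of x] that by (simp add: X_def)
  have tr_X: "r x z" if "x \<in> X" "y \<in> X" "z \<in> X" "r x y" "r y z" for x y z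
    using tr[of x y z] that by (simp add: X_def)
  have asym: "asymp_on X r"
  proof (rule asymp_onI)
    fix x y assume "x \<in> X" "y \<in> X" "r x y"
    then show "\<not> r y x" using irr[of x] tr_X[of x y x] by auto
  qed
  have "transp_on X r" using tr_X by (rule transp_onI)
  from Finite_Set.bex_min_element[OF fin asym this ne]
  obtain m where m: "m \<in> X" "\<And>x. x \<in> X \<Longrightarrow> x \<noteq> m \<Longrightarrow> \<not> r x m"
    by auto
  from m(1) have "m \<in> V" "r i m" "r m j" by (simp_all add: X_def)
  with mid[OF assms(3)] obtain l where l: "l \<in> V" "r i l" "r l m" by blast
  then have "l \<in> X" using \<open>m \<in> V\<close> \<open>r m j\<close> tr[of l m j] assms(4) by (simp add: X_def)
  with m(2)[of l] l(3) irr[of l] show False by auto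
qed

section \<open>Matrices with a fixed vector\<close>

text \<open>On the support \<open>S\<close> of \<open>v\<close>: no entry leads out of \<open>S\<close>, and an index \<open>j \<in> S\<close> with a nonzero
  column has the same row as the identity matrix. So \<open>R\<close> acts on vectors with support \<open>S\<close> as a
  block matrix with the identity and an arbitrary block below it in its first columns, and zeros
  elsewhere. The condition depends only on \<open>S\<close> and on which entries of \<open>R\<close> are 0 or 1.\<close>

definition absorbing :: "nat \<Rightarrow> int vec \<Rightarrow> int mat \<Rightarrow> bool" where
  "absorbing n v R \<longleftrightarrow> (\<forall>i<n. \<forall>j<n. v $ j \<noteq> 0 \<and> R $$ (i, j) \<noteq> 0 \<longrightarrow>
     v $ i \<noteq> 0 \<and> R $$ (j, j) = 1 \<and> (\<forall>l<n. l \<noteq> j \<and> v $ l \<noteq> 0 \<longrightarrow> R $$ (j, l) = 0))"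

lemma absorbingD:
  assumes "absorbing n v R" "i < n" "j < n" "v $ j \<noteq> 0" "R $$ (i, j) \<noteq> 0"
  shows "v $ i \<noteq> 0" "R $$ (j, j) = 1"
    and "l < n \<Longrightarrow> l \<noteq> j \<Longrightarrow> v $ l \<noteq> 0 \<Longrightarrow> R $$ (j, l) = 0"
  using assms(1)[unfolded absorbing_def, rule_format, OF assms(2,3)] assms(4,5) by blast+

text \<open>In row \<open>l\<close> of \<open>R v = v\<close> all terms are nonnegative. If \<open>l\<close> is in the support and has a nonzero
  diagonal entry, then the diagonal term already accounts for \<open>v $ l\<close>, so the diagonal entry is 1 and
  the rest of the row vanishes on the support. A nonzero entry at \<open>(i, j)\<close> factors through an index
  \<open>l\<close> with a loop, by idempotency; on the support the row of \<open>l\<close> is zero off the diagonal, so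
  \<open>l = j\<close>.\<close>

lemma absorbing_of_fixed_vector:
  assumes R: "R \<in> nonneg_int_mats n" and v: "v \<in> nonneg_int_vecs n"
    and idem: "trunc n (R * R) = trunc n R" and fixed: "R *\<^sub>v v = v"
  shows "absorbing n v R"
  unfolding absorbing_def
proof (intro allI impI)
  fix i j assume ij: "i < n" "j < n" and "v $ j \<noteq> 0 \<and> R $$ (i, j) \<noteq> 0"
  then have nz: "v $ j \<noteq> 0" "R $$ (i, j) \<noteq> 0" by auto
  have Rnn: "0 \<le> R $$ (i, j)" if "i < n" "j < n" for i j
    using R that by (auto simp: nonneg_int_mats_def)
  have vnn: "0 \<le> v $ i" if "i < n" for i using v that by (auto simp: nonneg_int_vecs_def)
  have carr: "R \<in> carrier_mat n n" "v \<in> carrier_vec n"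
    using R v by (auto simp: nonneg_int_mats_def nonneg_int_vecs_def)
  have row: "v $ i = (\<Sum>k<n. R $$ (i, k) * v $ k)" if "i < n" for i
    using mult_vec_entry[OF carr that] by (simp only: fixed)
  have row_ge: "(\<Sum>k\<in>K. R $$ (i, k) * v $ k) \<le> v $ i" if "i < n" "K \<subseteq> {..<n}" for i K
    unfolding row[OF that(1)] using that Rnn vnn by (intro sum_mono2) auto
  have support: "v $ i \<noteq> 0" if "i < n" "j < n" "v $ j \<noteq> 0" "R $$ (i, j) \<noteq> 0" for i j
  proof -
    have "0 < R $$ (i, j) * v $ j"
      using that Rnn[of i j] vnn[of j] by simp
    with row_ge[of i "{j}"] that show ?thesis by simp
  qed
  have loop: "R $$ (l, l) = 1 \<and> (\<forall>j<n. j \<noteq> l \<and> v $ j \<noteq> 0 \<longrightarrow> R $$ (l, j) = 0)"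
    if l: "l < n" "v $ l \<noteq> 0" "R $$ (l, l) \<noteq> 0" for l
  proof -
    have pos: "0 < v $ l" "1 \<le> R $$ (l, l)" using l Rnn[of l l] vnn[of l] by auto
    then have ge: "v $ l \<le> R $$ (l, l) * v $ l" by simp
    have "R $$ (l, l) * v $ l \<le> 1 * v $ l" using row_ge[of l "{l}"] l by simp
    then have "R $$ (l, l) \<le> 1" using pos by (simp add: mult_le_cancel_right)
    moreover have "R $$ (l, j) = 0" if "j < n" "j \<noteq> l" "v $ j \<noteq> 0" for j
    proof (rule ccontr)
      assume "R $$ (l, j) \<noteq> 0"
      then have "0 < R $$ (l, j) * v $ j" using that l Rnn[of l j] vnn[of j] by simp
      moreover have "R $$ (l, l) * v $ l + R $$ (l, j) * v $ j \<le> v $ l"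
        using row_ge[of l "{l, j}"] l that by simp
      ultimately show False using ge by simp
    qed
    ultimately show ?thesis using pos by auto
  qed
  \<comment> \<open>\<open>R * R\<close> has the same zero pattern as \<open>R\<close>, because the truncation determines it.\<close>
  have dense: "R $$ (a, b) \<noteq> 0 \<longleftrightarrow> (\<exists>l\<in>{..<n}. R $$ (a, l) \<noteq> 0 \<and> R $$ (l, b) \<noteq> 0)"
    if "a \<in> {..<n}" "b \<in> {..<n}" for a b
  proof -
    have ab: "a < n" "b < n" using that by auto
    have "min 2 ((R * R) $$ (a, b)) = min 2 (R $$ (a, b))" using idem ab by (simp add: trunc_eq_iff)
    then have "R $$ (a, b) = 0 \<longleftrightarrow> (R * R) $$ (a, b) = 0"
      by linarith
    also have "\<dots> \<longleftrightarrow> (\<Sum>l<n. R $$ (a, l) * R $$ (l, b)) = 0"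
      using mult_mat_entry[OF carr(1) carr(1) ab] by simp
    also have "\<dots> \<longleftrightarrow> (\<forall>l\<in>{..<n}. R $$ (a, l) * R $$ (l, b) = 0)"
      using ab Rnn by (intro sum_nonneg_eq_0_iff) auto
    finally show ?thesis by auto
  qed
  have "i \<in> {..<n}" "j \<in> {..<n}" using ij by auto
  from idempotent_relation_through_loop[OF finite_lessThan dense this nz(2)]
  obtain l where l: "l < n" "R $$ (i, l) \<noteq> 0" "R $$ (l, l) \<noteq> 0" "R $$ (l, j) \<noteq> 0"
    by (metis lessThan_iff)
  have "v $ l \<noteq> 0" using support l ij nz by blast
  with loop l ij nz have "j = l" by blast
  have "v $ i \<noteq> 0" using support ij nz by blast
  moreover have "R $$ (j, j) = 1 \<and> (\<forall>l<n. l \<noteq> j \<and> v $ l \<noteq> 0 \<longrightarrow> R $$ (j, l) = 0)"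
    using loop[of j] l(3) ij(2) nz(1) \<open>j = l\<close> by blast
  ultimately show "v $ i \<noteq> 0 \<and> R $$ (j, j) = 1 \<and> (\<forall>l<n. l \<noteq> j \<and> v $ l \<noteq> 0 \<longrightarrow> R $$ (j, l) = 0)"
    by blast
qed

lemma absorbing_cong:
  assumes "trunc n R' = trunc n R" "\<And>i. i < n \<Longrightarrow> v' $ i = 0 \<longleftrightarrow> v $ i = 0"
    and ab: "absorbing n v R"
  shows "absorbing n v' R'"
proof -
  have z: "R' $$ (i, j) = 0 \<longleftrightarrow> R $$ (i, j) = 0" and o: "R' $$ (i, j) = 1 \<longleftrightarrow> R $$ (i, j) = 1"
    if "i < n" "j < n" for i j
  proof -
    have "min 2 (R' $$ (i, j)) = min 2 (R $$ (i, j))" using assms(1) that by (simp add: trunc_eq_iff)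
    then show "R' $$ (i, j) = 0 \<longleftrightarrow> R $$ (i, j) = 0" "R' $$ (i, j) = 1 \<longleftrightarrow> R $$ (i, j) = 1"
      by (auto simp: min_def split: if_splits)
  qed
  show ?thesis
    unfolding absorbing_def
  proof (intro allI impI)
    fix i j assume ij: "i < n" "j < n" and "v' $ j \<noteq> 0 \<and> R' $$ (i, j) \<noteq> 0"
    then have "v $ j \<noteq> 0" "R $$ (i, j) \<noteq> 0" using z[OF ij] assms(2)[OF ij(2)] by simp_all
    note * = absorbingD[OF ab ij this]
    have "R' $$ (j, l) = 0" if "l < n" "l \<noteq> j" "v' $ l \<noteq> 0" for l
      using *(3) that z[OF ij(2) that(1)] assms(2)[OF that(1)] by simp
    with *(1,2) z[OF ij] o[OF ij(2) ij(2)] assms(2)[OF ij(1)]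
    show "v' $ i \<noteq> 0 \<and> R' $$ (j, j) = 1 \<and> (\<forall>l<n. l \<noteq> j \<and> v' $ l \<noteq> 0 \<longrightarrow> R' $$ (j, l) = 0)"
      by blast
  qed
qed

text \<open>Only those coordinates of \<open>R x\<close> enter \<open>R (R x)\<close> whose columns are nonzero, and in them \<open>R x\<close>
  agrees with \<open>x\<close>.\<close>

lemma absorbing_idempotent:
  assumes R: "R \<in> carrier_mat n n" and x: "x \<in> carrier_vec n" and ab: "absorbing n x R"
  shows "R *\<^sub>v (R *\<^sub>v x) = R *\<^sub>v x"
proof (rule eq_vecI)
  define y where "y = R *\<^sub>v x"
  have y: "y \<in> carrier_vec n" using R x by (simp add: y_def)
  have entry: "y $ j = (\<Sum>l<n. R $$ (j, l) * x $ l)" if "j < n" for j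
    unfolding y_def using mult_vec_entry[OF R x that] .
  fix i assume "i < dim_vec (R *\<^sub>v x)"
  then have i: "i < n" using R by simp
  have "R $$ (i, j) * y $ j = R $$ (i, j) * x $ j" if j: "j < n" for j
  proof (cases "R $$ (i, j) = 0")
    case False
    show ?thesis
    proof (cases "x $ j = 0")
      case True
      have "R $$ (j, l) * x $ l = 0" if "l < n" for l
        using absorbingD(1)[OF ab j that] True by (cases "x $ l = 0") auto
      then have "y $ j = 0" unfolding entry[OF j] by (intro sum.neutral) simp
      then show ?thesis using True by simp
    next
      case nz: False
      have row: "R $$ (j, j) = 1" using absorbingD(2)[OF ab i j nz False] .
      have "R $$ (j, l) * x $ l = 0" if "l < n" "l \<noteq> j" for l
        using absorbingD(3)[OF ab i j nz False that] by (cases "x $ l = 0") auto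
      with row have terms: "R $$ (j, l) * x $ l = (if l = j then x $ j else 0)" if "l < n" for l
        using that by simp
      have "y $ j = (\<Sum>l<n. if l = j then x $ j else 0)"
        unfolding entry[OF j] by (intro sum.cong refl terms) simp
      then show ?thesis using j by simp
    qed
  qed simp
  then have "(\<Sum>j<n. R $$ (i, j) * y $ j) = (\<Sum>j<n. R $$ (i, j) * x $ j)"
    by (intro sum.cong) auto
  then show "(R *\<^sub>v (R *\<^sub>v x)) $ i = (R *\<^sub>v x) $ i"
    using mult_vec_entry[OF R y i] mult_vec_entry[OF R x i] by (simp add: y_def)
qed (use R in simp)

lemma support_mult_vec_cong:
  assumes "P \<in> nonneg_int_mats n" "P' \<in> nonneg_int_mats n" "u \<in> nonneg_int_vecs n"
    and "trunc n P' = trunc n P" "i < n"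
  shows "(P' *\<^sub>v u) $ i = 0 \<longleftrightarrow> (P *\<^sub>v u) $ i = 0"
proof -
  have supp: "(X *\<^sub>v u) $ i = 0 \<longleftrightarrow> (\<forall>k\<in>{..<n}. X $$ (i, k) * u $ k = 0)"
    if "X \<in> nonneg_int_mats n" for X
    using that assms(3,5)
    by (subst mult_vec_entry[where n = n])
      (auto simp: nonneg_int_mats_def nonneg_int_vecs_def simp del: mult_eq_0_iff
        intro!: sum_nonneg_eq_0_iff)
  have "P' $$ (i, k) = 0 \<longleftrightarrow> P $$ (i, k) = 0" if "k < n" for k
  proof -
    have "min 2 (P' $$ (i, k)) = min 2 (P $$ (i, k))"
      using assms(4,5) that by (simp add: trunc_eq_iff)
    then show ?thesis by linarith
  qed
  then show ?thesis unfolding supp[OF assms(1)] supp[OF assms(2)] by auto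
qed

text \<open>The loop \<open>q\<close> is first iterated until its truncation is idempotent, and only then are both words
  shortened. The shortened loop need not fix the vector reached by \<open>p'\<close>; it has to be run once
  before it repeats.\<close>

lemma short_loop:
  assumes M: "M \<subseteq> nonneg_int_mats n" and u: "u \<in> nonneg_int_vecs n"
    and p: "set p \<subseteq> M" and q: "set q \<subseteq> M" "q \<noteq> []"
    and loop: "word_mat n q *\<^sub>v (word_mat n p *\<^sub>v u) = word_mat n p *\<^sub>v u"
  obtains p' q' where "set p' \<subseteq> M" "set q' \<subseteq> M" "q' \<noteq> []"
    "length p' \<le> 3 ^ (n * n)" "length q' \<le> 3 ^ (n * n)"
    "word_mat n (p' @ q' @ q') *\<^sub>v u = word_mat n (p' @ q') *\<^sub>v u"
proof -
  define v where "v = word_mat n p *\<^sub>v u"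
  define qs where "qs k = concat (replicate k q)" for k
  have qs: "set (qs k) \<subseteq> M" for k using q(1) by (auto simp: qs_def)
  have nn: "word_mat n w \<in> nonneg_int_mats n" "word_mat n w \<in> carrier_mat n n" if "set w \<subseteq> M" for w
    using that M word_mat_nonneg[of w n] word_mat_carrier[of w n] by auto
  have app: "word_mat n (w @ w') = word_mat n w' * word_mat n w" if "set w \<subseteq> M" "set w' \<subseteq> M" for w w'
    using that M by (intro word_mat_append) auto
  have v: "v \<in> nonneg_int_vecs n" unfolding v_def using nn p u by (intro nonneg_mult_vec) auto
  then have vc: "v \<in> carrier_vec n" and uc: "u \<in> carrier_vec n"
    using u by (auto simp: nonneg_int_vecs_def)
  obtain k where k: "0 < k" "trunc n (word_mat n (qs (k + k))) = trunc n (word_mat n (qs k))"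
  proof (rule idempotent_index[of "\<lambda>k. trunc n (word_mat n (qs k))"])
    show "finite (range (\<lambda>k. trunc n (word_mat n (qs k))))"
      using nn qs by (intro finite_subset[OF _ finite_trunc_mats[of n]]) (auto intro: trunc_in_trunc_mats)
  next
    fix a b assume "trunc n (word_mat n (qs a)) = trunc n (word_mat n (qs b))"
    moreover have "word_mat n (qs (Suc k)) = word_mat n (qs k) * word_mat n q" for k
      using app[OF q(1) qs] by (simp add: qs_def)
    ultimately show "trunc n (word_mat n (qs (Suc a))) = trunc n (word_mat n (qs (Suc b)))"
      using nn qs q by (auto intro: trunc_mult_right_cong)
  qed blast
  have double: "word_mat n (qs (k + k)) = word_mat n (qs k) * word_mat n (qs k)"
    using app[OF qs qs, of k k] by (simp add: qs_def replicate_add)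
  have fixed: "word_mat n (qs j) *\<^sub>v v = v" for j
  proof (induction j)
    case 0
    then show ?case using vc by (simp add: qs_def)
  next
    case (Suc j)
    have "word_mat n (qs (Suc j)) = word_mat n (qs j) * word_mat n q"
      using app[OF q(1) qs] by (simp add: qs_def)
    then show ?case
      using Suc loop vc nn[OF qs, of j] nn[OF q(1)] by (simp add: v_def assoc_mult_mat_vec[of _ n n])
  qed
  have ab: "absorbing n v (word_mat n (qs k))"
    using absorbing_of_fixed_vector[OF nn(1)[OF qs] v k(2)[unfolded double] fixed] .
  obtain p' where p': "set p' \<subseteq> M" "trunc n (word_mat n p') = trunc n (word_mat n p)"
    "length p' \<le> 3 ^ (n * n)"
    using short_word_mat[OF p M] by metis
  obtain q' where q': "set q' \<subseteq> M" "trunc n (word_mat n q') = trunc n (word_mat n (qs k))"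
    "length q' \<le> 3 ^ (n * n)" "q' = [] \<longleftrightarrow> qs k = []"
    using short_word_mat[OF qs M] by metis
  have "q' \<noteq> []" using q'(4) q(2) k(1) by (simp add: qs_def)
  define x where "x = word_mat n p' *\<^sub>v u"
  have xc: "x \<in> carrier_vec n" unfolding x_def using nn[OF p'(1)] uc by simp
  have "absorbing n x (word_mat n q')"
    using absorbing_cong[OF q'(2) _ ab]
      support_mult_vec_cong[OF nn(1)[OF p] nn(1)[OF p'(1)] u p'(2)]
    unfolding x_def v_def by blast
  then have idem: "word_mat n q' *\<^sub>v (word_mat n q' *\<^sub>v x) = word_mat n q' *\<^sub>v x"
    using nn(2)[OF q'(1)] xc by (intro absorbing_idempotent)
  have act: "word_mat n (w @ q') *\<^sub>v u = word_mat n q' *\<^sub>v (word_mat n w *\<^sub>v u)"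
    if "set w \<subseteq> M" for w
    unfolding app[OF that q'(1)] using assoc_mult_mat_vec[OF nn(2)[OF q'(1)] nn(2)[OF that] uc] .
  have "word_mat n (p' @ q' @ q') *\<^sub>v u = word_mat n q' *\<^sub>v (word_mat n q' *\<^sub>v x)"
    using act[of "p' @ q'"] act[of p'] p'(1) q'(1) by (simp add: x_def)
  also have "\<dots> = word_mat n (p' @ q') *\<^sub>v u"
    using idem act[OF p'(1)] by (simp add: x_def)
  finally show thesis using that p' q' \<open>q' \<noteq> []\<close> by metis
qed

section \<open>Orbits\<close>

definition orbit :: "int mat list \<Rightarrow> int vec \<Rightarrow> (nat \<Rightarrow> nat) \<Rightarrow> nat \<Rightarrow> int vec" where
  "orbit As u s t = rec_nat u (\<lambda>i v. (As ! s i) *\<^sub>v v) t"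

lemma orbit_simps [simp]:
  "orbit As u s 0 = u" "orbit As u s (Suc t) = (As ! s t) *\<^sub>v orbit As u s t"
  by (simp_all add: orbit_def)

lemma orbit_eq_word_mat:
  assumes "set As \<subseteq> nonneg_int_mats n" "u \<in> nonneg_int_vecs n" "\<And>i. i < t \<Longrightarrow> s i < length As"
  shows "orbit As u s t = word_mat n (map (\<lambda>i. As ! s i) [0..<t]) *\<^sub>v u"
  using assms(3)
proof (induction t)
  case 0
  then show ?case using assms(2) by (simp add: nonneg_int_vecs_def)
next
  case (Suc t)
  let ?w = "map (\<lambda>i. As ! s i) [0..<t]"
  have w: "set ?w \<subseteq> nonneg_int_mats n" using assms(1) Suc.prems by fastforce
  have A: "As ! s t \<in> nonneg_int_mats n" using assms(1) Suc.prems[of t] by (meson lessI nth_mem subsetD)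
  have "word_mat n (?w @ [As ! s t]) = As ! s t * word_mat n ?w"
    using word_mat_append[OF w, of "[As ! s t]"] A
    by (simp add: nonneg_int_mats_def left_mult_one_mat[of _ n n])
  then show ?case
    using Suc A word_mat_carrier[OF w] assms(2)
    by (simp add: nonneg_int_mats_def nonneg_int_vecs_def assoc_mult_mat_vec[of _ n n])
qed

lemma orbit_nonneg:
  assumes "set As \<subseteq> nonneg_int_mats n" "u \<in> nonneg_int_vecs n" "\<And>i. i < t \<Longrightarrow> s i < length As"
  shows "orbit As u s t \<in> nonneg_int_vecs n"
  using assms(3)
proof (induction t)
  case (Suc t)
  then have "As ! s t \<in> nonneg_int_mats n" using assms(1) by (meson lessI nth_mem subsetD)
  with Suc show ?case by (auto intro: nonneg_mult_vec)
qed (use assms in simp)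

lemma finite_bounded_nonneg_vecs: "finite {v \<in> nonneg_int_vecs n. \<forall>j<n. v $ j \<le> B}"
proof (rule finite_subset)
  show "{v \<in> nonneg_int_vecs n. \<forall>j<n. v $ j \<le> B} \<subseteq>
    vec_of_list ` {xs. set xs \<subseteq> {0..B} \<and> length xs = n}"
  proof
    fix v assume v: "v \<in> {v \<in> nonneg_int_vecs n. \<forall>j<n. v $ j \<le> B}"
    then have "set (list_of_vec v) \<subseteq> {0..B}" "length (list_of_vec v) = n"
      by (auto simp: nonneg_int_vecs_def in_set_conv_nth)
    then show "v \<in> vec_of_list ` {xs. set xs \<subseteq> {0..B} \<and> length xs = n}"
      by (intro image_eqI[of _ _ "list_of_vec v"]) (auto simp: vec_list)
  qed
qed (simp add: finite_lists_length_eq)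

lemma bounded_orbit_repeats:
  assumes "set As \<subseteq> nonneg_int_mats n" "u \<in> nonneg_int_vecs n" "\<And>i. s i < length As"
    and "bounded_vecs n (orbit As u s)"
  obtains a b where "a < b" "orbit As u s a = orbit As u s b"
proof -
  obtain B where B: "\<And>t j. j < n \<Longrightarrow> \<bar>orbit As u s t $ j\<bar> \<le> B"
    using assms(4) by (auto simp: bounded_vecs_def)
  have "orbit As u s t $ j \<le> B" if "j < n" for t j using B[OF that, of t] by linarith
  then have "range (orbit As u s) \<subseteq> {v \<in> nonneg_int_vecs n. \<forall>j<n. v $ j \<le> B}"
    using orbit_nonneg[OF assms(1,2)] assms(3) by auto
  then have "finite (range (orbit As u s))" using finite_bounded_nonneg_vecs finite_subset by blast
  then obtain a b where "a < b" "orbit As u s a = orbit As u s b"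
    by (metis finite_imageD infinite_UNIV_nat injI linorder_neqE_nat)
  with that show thesis .
qed

text \<open>The positions \<open>\<sigma> k\<close> run up to \<open>b - 1\<close> and then jump back to \<open>a\<close>, so only the first \<open>b\<close> vectors of
  the orbit are visited.\<close>

lemma bounded_trajectory_of_repetition:
  assumes "u \<in> set us" "\<And>i. s i < length As" "a < b" "orbit As u s a = orbit As u s b"
  shows "has_bounded_trajectory (n, As, us)"
proof -
  define \<sigma> where "\<sigma> k = rec_nat 0 (\<lambda>_ i. if Suc i = b then a else Suc i) k" for k :: nat
  have \<sigma>: "\<sigma> 0 = 0" "\<sigma> (Suc k) = (if Suc (\<sigma> k) = b then a else Suc (\<sigma> k))" for k
    by (simp_all add: \<sigma>_def)
  have \<sigma>_less: "\<sigma> k < b" for k using assms(3) by (induction k) (auto simp: \<sigma>)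
  let ?v = "\<lambda>k. orbit As u s (\<sigma> k)"
  have step: "?v (Suc k) = (As ! s (\<sigma> k)) *\<^sub>v ?v k" for k
  proof -
    have "?v (Suc k) = orbit As u s (Suc (\<sigma> k))"
      using assms(4) by (simp only: \<sigma> split: if_split) metis
    then show ?thesis by simp
  qed
  define B where "B = Max ((\<lambda>(k, j). \<bar>orbit As u s k $ j\<bar>) ` ({..<b} \<times> {..<n}))"
  have "\<bar>?v k $ j\<bar> \<le> B" if "j < n" for k j
    unfolding B_def using \<sigma>_less[of k] that by (intro Max_ge) force+
  then have "bounded_vecs n ?v" by (auto simp: bounded_vecs_def)
  moreover have "?v 0 \<in> set us" using assms(1) by (simp add: \<sigma>)
  ultimately show ?thesis
    unfolding has_bounded_trajectory.simps
    by (intro exI[of _ "\<lambda>t. s (\<sigma> t)"] exI[of _ ?v] conjI allI assms(2) step)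
qed

lemma orbit_cong: "(\<And>i. i < t \<Longrightarrow> s i = s' i) \<Longrightarrow> orbit As u s t = orbit As u s' t"
  by (induction t) auto

lemma ex_digits:
  fixes m :: nat
  assumes "\<And>i. i < L \<Longrightarrow> s i < m"
  obtains w where "w < m ^ L" "\<And>i. i < L \<Longrightarrow> w div m ^ i mod m = s i"
proof -
  have "\<exists>w<m ^ L. \<forall>i<L. w div m ^ i mod m = s i" using assms
  proof (induction L arbitrary: s)
    case (Suc L)
    obtain w where w: "w < m ^ L" "\<And>i. i < L \<Longrightarrow> w div m ^ i mod m = s (Suc i)"
      using Suc.IH[of "\<lambda>i. s (Suc i)"] Suc.prems by auto
    let ?w = "s 0 + m * w"
    have s0: "s 0 < m" using Suc.prems by simp
    have "?w < m * Suc w" using s0 by simp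
    also have "\<dots> \<le> m * m ^ L" using w(1) by (intro mult_le_mono2) simp
    finally have "?w < m ^ Suc L" by simp
    moreover have "?w div m ^ i mod m = s i" if "i < Suc L" for i
    proof (cases i)
      case 0
      then show ?thesis using s0 by simp
    next
      case (Suc j)
      have "?w div m ^ Suc j = (?w div m) div m ^ j" by (simp add: div_mult2_eq)
      also have "?w div m = w" using s0 by simp
      finally show ?thesis using Suc that w(2)[of j] by simp
    qed
    ultimately show ?case by blast
  qed simp
  then show thesis using that by blast
qed

text \<open>The part of the orbit before the first of the two equal vectors and the part between them are the
  words \<open>p\<close> and \<open>q\<close> of the preceding argument. The new orbit follows \<open>p'\<close>, \<open>q'\<close> and \<open>q'\<close> again, which
  accounts for the factor 3 in the bound.\<close>

lemma short_repetition:
  assumes As: "set As \<subseteq> nonneg_int_mats n" and u: "u \<in> nonneg_int_vecs n"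
    and s: "\<And>i. s i < length As" and "a < b" "orbit As u s a = orbit As u s b"
  obtains s' a' b' where "\<And>i. s' i < length As" "a' < b'" "b' \<le> 3 ^ (n * n + 1)"
    "orbit As u s' a' = orbit As u s' b'"
proof -
  let ?f = "\<lambda>i. As ! s i"
  define p q where "p = map ?f [0..<a]" and "q = map ?f [a..<b]"
  have p: "set p \<subseteq> set As" and q: "set q \<subseteq> set As" "q \<noteq> []"
    using s \<open>a < b\<close> by (auto simp: p_def q_def)
  have pq: "p @ q = map ?f [0..<b]"
    using \<open>a < b\<close> upt_add_eq_append[of 0 a "b - a"] by (simp add: p_def q_def flip: map_append)
  have orb: "orbit As u s t = word_mat n (map ?f [0..<t]) *\<^sub>v u" for t
    using orbit_eq_word_mat[OF As u] s by blast
  have "word_mat n (p @ q) *\<^sub>v u = word_mat n p *\<^sub>v u"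
    using assms(5) by (simp add: orb pq) (simp add: p_def)
  moreover have "word_mat n (p @ q) = word_mat n q * word_mat n p"
    using p q As by (intro word_mat_append) auto
  moreover have "word_mat n q \<in> carrier_mat n n" "word_mat n p \<in> carrier_mat n n"
    using p q As by (auto intro!: word_mat_carrier)
  moreover have "u \<in> carrier_vec n" using u by (simp add: nonneg_int_vecs_def)
  ultimately have "word_mat n q *\<^sub>v (word_mat n p *\<^sub>v u) = word_mat n p *\<^sub>v u"
    by (simp add: assoc_mult_mat_vec[of _ n n])
  from short_loop[OF As u p q this]
  obtain p' q' where p': "set p' \<subseteq> set As" "length p' \<le> 3 ^ (n * n)"
    and q': "set q' \<subseteq> set As" "q' \<noteq> []" "length q' \<le> 3 ^ (n * n)"
    and eq: "word_mat n (p' @ q' @ q') *\<^sub>v u = word_mat n (p' @ q') *\<^sub>v u"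
    by metis
  \<comment> \<open>Beyond the end of this word, the sequence of indices may continue in any way.\<close>
  define W where "W = p' @ q' @ q'"
  have "\<exists>k<length As. t < length W \<longrightarrow> As ! k = W ! t" for t
  proof (cases "t < length W")
    case True
    then have "W ! t \<in> set As" using p' q' nth_mem[OF True] by (auto simp: W_def)
    then show ?thesis by (metis in_set_conv_nth)
  next
    case False
    with s[of t] show ?thesis by blast
  qed
  then have "\<forall>t. \<exists>k. k < length As \<and> (t < length W \<longrightarrow> As ! k = W ! t)" by blast
  from choice[OF this] obtain s' where
    "\<forall>t. s' t < length As \<and> (t < length W \<longrightarrow> As ! s' t = W ! t)" ..
  then have s': "\<And>t. s' t < length As" "\<And>t. t < length W \<Longrightarrow> As ! s' t = W ! t"
    by simp_all
  have "orbit As u s' t = word_mat n (take t W) *\<^sub>v u" if "t \<le> length W" for t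
  proof -
    have "map (\<lambda>i. As ! s' i) [0..<t] = take t W"
      using that s'(2) by (intro nth_equalityI) auto
    then show ?thesis using orbit_eq_word_mat[OF As u, of t s'] s'(1) by simp
  qed
  note orb' = this
  have "take (length (p' @ q')) W = p' @ q'" "take (length W) W = p' @ q' @ q'"
    by (simp_all add: W_def)
  with orb'[of "length (p' @ q')"] orb'[of "length W"] eq
  have rep: "orbit As u s' (length (p' @ q')) = orbit As u s' (length W)"
    by (simp add: W_def del: take_append append_assoc)
  have "length (p' @ q') < length W" "length W \<le> 3 ^ (n * n + 1)"
    using p' q' by (auto simp: W_def)
  from that[OF s'(1) this rep] show thesis .
qed

text \<open>The digits of \<open>w\<close> in base \<open>length As\<close> are the indices of the first \<open>L\<close> matrices. If there are no
  matrices and \<open>L\<close> is positive, then no \<open>w\<close> qualifies.\<close>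

definition repetition_within :: "nat \<Rightarrow> int mat list \<Rightarrow> int vec list \<Rightarrow> bool" where
  "repetition_within L As us \<longleftrightarrow>
    (\<exists>w<length As ^ L. \<exists>k<length us. \<exists>b<Suc L. \<exists>a<b.
      orbit As (us ! k) (\<lambda>i. w div length As ^ i mod length As) a =
      orbit As (us ! k) (\<lambda>i. w div length As ^ i mod length As) b)"

lemma has_bounded_trajectory_iff_repetition:
  assumes "(n, As, us) \<in> instances"
  shows "has_bounded_trajectory (n, As, us) \<longleftrightarrow> repetition_within (3 ^ (n * n + 1)) As us"
proof
  let ?L = "3 ^ (n * n + 1)"
  have inst: "set As \<subseteq> nonneg_int_mats n" "set us \<subseteq> nonneg_int_vecs n"
    using assms by (auto simp: instances_def)
  assume "has_bounded_trajectory (n, As, us)"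
  then obtain s v where "(\<forall>t. s t < length As) \<and> v 0 \<in> set us \<and>
      (\<forall>t. v (Suc t) = (As ! s t) *\<^sub>v v t) \<and> bounded_vecs n v"
    unfolding has_bounded_trajectory.simps by (elim exE)
  then have sv: "\<And>t. s t < length As" "v 0 \<in> set us"
    "\<And>t. v (Suc t) = (As ! s t) *\<^sub>v v t" "bounded_vecs n v" by simp_all
  have "v t = orbit As (v 0) s t" for t by (induction t) (simp_all add: sv(3))
  then have v: "v = orbit As (v 0) s" by (rule ext)
  have u: "v 0 \<in> nonneg_int_vecs n" using sv(2) inst by auto
  have "bounded_vecs n (orbit As (v 0) s)" by (rule back_subst[of "bounded_vecs n", OF sv(4) v])
  from bounded_orbit_repeats[OF inst(1) u sv(1) this]
  obtain a b where "a < b" "orbit As (v 0) s a = orbit As (v 0) s b" .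
  from short_repetition[OF inst(1) u sv(1) this]
  obtain s' a' b' where s': "\<And>i. s' i < length As" "a' < b'" "b' \<le> ?L"
    "orbit As (v 0) s' a' = orbit As (v 0) s' b'" by metis
  obtain w where w: "w < length As ^ ?L" "\<And>i. i < ?L \<Longrightarrow> w div length As ^ i mod length As = s' i"
    using ex_digits[of ?L s' "length As"] s'(1) by blast
  obtain k where k: "k < length us" "us ! k = v 0" using sv(2) by (metis in_set_conv_nth)
  have "orbit As (v 0) (\<lambda>i. w div length As ^ i mod length As) t = orbit As (v 0) s' t"
    if "t \<le> ?L" for t using that w(2) by (intro orbit_cong) auto
  then have "orbit As (us ! k) (\<lambda>i. w div length As ^ i mod length As) a' =
      orbit As (us ! k) (\<lambda>i. w div length As ^ i mod length As) b'"
    using s' k by simp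
  then show "repetition_within ?L As us"
    unfolding repetition_within_def using w(1) k(1) s'(2,3) by (meson le_imp_less_Suc)
next
  let ?L = "3 ^ (n * n + 1)"
  assume "repetition_within ?L As us"
  then obtain w k a b where *: "w < length As ^ ?L" "k < length us" "a < b"
    "orbit As (us ! k) (\<lambda>i. w div length As ^ i mod length As) a =
      orbit As (us ! k) (\<lambda>i. w div length As ^ i mod length As) b"
    by (auto simp: repetition_within_def)
  have "0 < length As"
  proof (rule ccontr)
    assume "\<not> 0 < length As"
    with *(1) show False by (simp add: power_0_left)
  qed
  with * show "has_bounded_trajectory (n, As, us)"
    by (intro bounded_trajectory_of_repetition[of "us ! k" us
          "\<lambda>i. w div length As ^ i mod length As" As a b n]) auto
qed

section \<open>A calculus of computable functions\<close>

text \<open>\<open>e\<close> ranges over environments and \<open>Es\<close> lists the variables, that is, the coordinates of \<open>e\<close> that a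
  program gets as arguments. Since the function of \<open>e\<close> is an ordinary term, closure
  rules can be applied to such terms by resolution, with no explicit programs.\<close>

definition computable :: "('e \<Rightarrow> nat) list \<Rightarrow> ('e \<Rightarrow> nat) \<Rightarrow> bool" where
  "computable Es f \<longleftrightarrow> (\<exists>p. \<forall>e. halts_with p (map (\<lambda>x. x e) Es) (f e))"

text \<open>The body of a recursion, sum or quantifier sees one more variable, put in front of the others.\<close>

definition push_var :: "('e \<Rightarrow> nat) list \<Rightarrow> (nat \<times> 'e \<Rightarrow> nat) list" where
  "push_var Es = fst # map (\<lambda>x z. x (snd z)) Es"

lemma computable_var: "f \<in> set Es \<Longrightarrow> computable Es f"
proof -
  assume "f \<in> set Es"
  then obtain i where "i < length Es" "Es ! i = f" by (metis in_set_conv_nth)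
  then have "halts_with (Proj i) (map (\<lambda>x. x e) Es) (f e)" for e
    using proj[of i "map (\<lambda>x. x e) Es"] by simp
  then show ?thesis unfolding computable_def by blast
qed

text \<open>The program for the composition is \<open>Comp\<close>, with one argument program for each variable of \<open>h\<close>.\<close>

lemma computable_subst:
  assumes "computable Ds h" "\<And>x. x \<in> set Ds \<Longrightarrow> computable Es (\<lambda>e. x (s e))"
  shows "computable Es (\<lambda>e. h (s e))"
proof -
  obtain p where p: "\<And>d. halts_with p (map (\<lambda>x. x d) Ds) (h d)"
    using assms(1) by (auto simp: computable_def)
  obtain q where q: "\<And>x e. x \<in> set Ds \<Longrightarrow> halts_with (q x) (map (\<lambda>x. x e) Es) (x (s e))"
    using assms(2) unfolding computable_def by metis
  have "halts_with (Comp p (map q Ds)) (map (\<lambda>x. x e) Es) (h (s e))" for e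
    using q by (intro comp[where ys = "map (\<lambda>x. x (s e)) Ds"] p)
      (simp add: list_all2_conv_all_nth)
  then show ?thesis unfolding computable_def by blast
qed

lemma computable_weaken: "computable Es f \<Longrightarrow> computable (push_var Es) (\<lambda>z. f (snd z))"
  by (erule computable_subst) (auto simp: push_var_def intro!: computable_var)

lemma computable_weaken2: "computable Es f \<Longrightarrow> computable (push_var (push_var Es)) (\<lambda>z. f (snd (snd z)))"
  by (rule computable_weaken[OF computable_weaken])

lemma computable_newest_var: "computable (push_var Es) fst"
  by (rule computable_var) (simp add: push_var_def)

lemma computable_second_var: "computable (push_var (push_var Es)) (\<lambda>z. fst (snd z))"
  by (rule computable_var) (simp add: push_var_def)

text \<open>\<open>PrimRec\<close> presents its step program with the counter, the previous value and the parameters, in this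
  order, so the variable for the value is pushed before the one for the counter.\<close>

lemma computable_rec_nat:
  assumes a: "computable Es a" and b: "computable Es b"
    and g: "computable (push_var (push_var Es)) (\<lambda>z. g (fst z) (fst (snd z)) (snd (snd z)))"
  shows "computable Es (\<lambda>e. rec_nat (a e) (\<lambda>n y. g n y e) (b e))"
proof -
  let ?E = "\<lambda>e. map (\<lambda>x. x e) Es"
  obtain p where p: "\<And>e. halts_with p (?E e) (a e)" using a by (auto simp: computable_def)
  obtain q where "\<And>z. halts_with q (map (\<lambda>x. x z) (push_var (push_var Es))) (g (fst z) (fst (snd z)) (snd (snd z)))"
    using g unfolding computable_def by blast
  from this[of "(_, _, _)"] have q: "halts_with q (n # y # ?E e) (g n y e)" for n y e
    by (simp add: push_var_def comp_def)
  have "halts_with (PrimRec p q) (n # ?E e) (rec_nat (a e) (\<lambda>n y. g n y e) n)" for n e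
    by (induction n) (auto intro: primrec_0 primrec_Suc p q)
  then have "\<forall>z. halts_with (PrimRec p q) (map (\<lambda>x. x z) (push_var Es))
      (rec_nat (a (snd z)) (\<lambda>n y. g n y (snd z)) (fst z))"
    by (simp add: push_var_def comp_def)
  then have "computable (push_var Es) (\<lambda>z. rec_nat (a (snd z)) (\<lambda>n y. g n y (snd z)) (fst z))"
    unfolding computable_def by blast
  moreover have "computable Es (\<lambda>e. x (b e, e))" if "x \<in> set (push_var Es)" for x
    using that b by (auto simp: push_var_def intro: computable_var)
  ultimately show ?thesis
    using computable_subst[where s = "\<lambda>e. (b e, e)" and Es = Es] by fastforce
qed

lemma computable_Suc: "computable Es f \<Longrightarrow> computable Es (\<lambda>e. Suc (f e))"
proof -
  assume f: "computable Es f"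
  have "computable [\<lambda>n. n] Suc" unfolding computable_def by (auto intro: succ)
  from computable_subst[OF this, of Es f] f show ?thesis by simp
qed

lemma computable_const: "computable Es (\<lambda>_. k)"
proof (induction k)
  case 0
  show ?case unfolding computable_def by (auto intro: zero)
qed (rule computable_Suc)

lemma computable_add:
  assumes "computable Es a" "computable Es b"
  shows "computable Es (\<lambda>e. a e + b e)"
proof -
  have "rec_nat m (\<lambda>_ y. Suc y) n = m + n" for m n by (induction n) auto
  moreover have "computable Es (\<lambda>e. rec_nat (a e) (\<lambda>n y. Suc y) (b e))"
    by (intro computable_rec_nat assms computable_Suc computable_second_var)
  ultimately show ?thesis by simp
qed

lemma computable_mult:
  assumes "computable Es a" "computable Es b"
  shows "computable Es (\<lambda>e. a e * b e)"
proof -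
  have "rec_nat 0 (\<lambda>_ y. y + m) n = m * n" for m n :: nat by (induction n) auto
  moreover have "computable Es (\<lambda>e. rec_nat 0 (\<lambda>n y. y + a e) (b e))"
    by (intro computable_rec_nat assms computable_const computable_add computable_second_var
        computable_weaken2)
  ultimately show ?thesis by simp
qed

lemma computable_power:
  assumes "computable Es a" "computable Es b"
  shows "computable Es (\<lambda>e. a e ^ b e)"
proof -
  have "rec_nat 1 (\<lambda>_ y. y * m) n = m ^ n" for m n :: nat by (induction n) auto
  moreover have "computable Es (\<lambda>e. rec_nat 1 (\<lambda>n y. y * a e) (b e))"
    by (intro computable_rec_nat assms computable_const computable_mult computable_second_var
        computable_weaken2)
  ultimately show ?thesis by simp
qed

lemma computable_diff:
  assumes "computable Es a" "computable Es b"
  shows "computable Es (\<lambda>e. a e - b e)"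
proof -
  have "rec_nat 0 (\<lambda>n _. n) m = m - 1" for m by (cases m) auto
  moreover have "computable (push_var (push_var Es)) (\<lambda>z. rec_nat 0 (\<lambda>n _. n) (fst (snd z)))"
    by (intro computable_rec_nat computable_const computable_second_var computable_newest_var)
  ultimately have pred: "computable (push_var (push_var Es)) (\<lambda>z. fst (snd z) - 1)" by simp
  have "rec_nat m (\<lambda>_ y. y - 1) n = m - n" for m n :: nat by (induction n) auto
  moreover have "computable Es (\<lambda>e. rec_nat (a e) (\<lambda>n y. y - 1) (b e))"
    by (intro computable_rec_nat assms pred)
  ultimately show ?thesis by simp
qed

lemma computable_subst_bound:
  assumes "computable (push_var Es) (\<lambda>z. g (fst z) (snd z))" "computable (push_var (push_var Es)) a"
  shows "computable (push_var (push_var Es)) (\<lambda>z. g (a z) (snd (snd z)))"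
proof -
  have "computable (push_var (push_var Es)) (\<lambda>z. x (a z, snd (snd z)))" if "x \<in> set (push_var Es)" for x
    using that assms(2) by (auto simp: push_var_def intro: computable_var)
  then show ?thesis
    using computable_subst[OF assms(1), of "push_var (push_var Es)" "\<lambda>z. (a z, snd (snd z))"] by simp
qed

lemma computable_sum:
  assumes "computable Es b" "computable (push_var Es) (\<lambda>z. g (fst z) (snd z))"
  shows "computable Es (\<lambda>e. \<Sum>n<b e. g n e)"
proof -
  have "rec_nat 0 (\<lambda>n y. y + g n e) m = (\<Sum>n<m. g n e)" for m e by (induction m) auto
  moreover have "computable (push_var (push_var Es)) (\<lambda>z. g (fst z) (snd (snd z)))"
    using assms(2) computable_newest_var by (rule computable_subst_bound)
  then have "computable Es (\<lambda>e. rec_nat 0 (\<lambda>n y. y + g n e) (b e))"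
    by (intro computable_rec_nat assms computable_const computable_add computable_second_var)
  ultimately show ?thesis by simp
qed

lemma computable_eq:
  assumes "computable Es a" "computable Es b"
  shows "computable Es (\<lambda>e. of_bool (a e = b e))"
proof -
  have "of_bool (m = n) = 1 - ((m - n) + (n - m))" for m n :: nat by auto
  moreover have "computable Es (\<lambda>e. 1 - ((a e - b e) + (b e - a e)))"
    by (intro computable_diff computable_add computable_const assms)
  ultimately show ?thesis by simp
qed

lemma computable_le:
  assumes "computable Es a" "computable Es b"
  shows "computable Es (\<lambda>e. of_bool (a e \<le> b e))"
proof -
  have "of_bool (m \<le> n) = 1 - (m - n)" for m n :: nat by auto
  moreover have "computable Es (\<lambda>e. 1 - (a e - b e))"
    by (intro computable_diff computable_const assms)
  ultimately show ?thesis by simp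
qed

text \<open>A bounded search is a bounded sum of truth values, cut off at 1 by truncated subtraction.\<close>

lemma computable_Ex_less:
  assumes "computable Es b" "computable (push_var Es) (\<lambda>z. of_bool (P (fst z) (snd z)))"
  shows "computable Es (\<lambda>e. of_bool (\<exists>n<b e. P n e))"
proof -
  have "of_bool (\<exists>n<m. P n e) = 1 - (1 - (\<Sum>n<m. of_bool (P n e)) :: nat)" for m e
  proof -
    let ?s = "\<Sum>n<m. of_bool (P n e) :: nat"
    have "?s = 0 \<longleftrightarrow> (\<forall>n<m. \<not> P n e)" by (subst sum_eq_0_iff) auto
    then have "(\<exists>n<m. P n e) \<longleftrightarrow> ?s \<noteq> 0" by metis
    moreover have "of_bool (s \<noteq> 0) = 1 - (1 - s)" for s :: nat by auto
    ultimately show ?thesis by (simp only:)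
  qed
  moreover have "computable Es (\<lambda>e. 1 - (1 - (\<Sum>n<b e. of_bool (P n e))))"
    by (intro computable_diff computable_sum computable_const assms)
  ultimately show ?thesis by simp
qed

lemma computable_div:
  assumes "computable Es a" "computable Es b"
  shows "computable Es (\<lambda>e. a e div b e)"
proof -
  \<comment> \<open>The quotient counts the positive multiples of \<open>n\<close> up to \<open>m\<close>; the second factor makes division by 0 yield 0.\<close>
  have "m div n = (\<Sum>q<m. of_bool (Suc q * n \<le> m) * (1 - of_bool (n = 0)))" for m n :: nat
  proof (cases "n = 0")
    case False
    have le_iff: "Suc q * n \<le> m \<longleftrightarrow> q < m div n" for q
      using False less_eq_div_iff_mult_less_eq[of n "Suc q" m] by (simp add: Suc_le_eq)
    have "of_bool (Suc q * n \<le> m) * (1 - of_bool (n = 0)) = (of_bool (q < m div n) :: nat)" for q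
      unfolding le_iff using False by simp
    then have "(\<Sum>q<m. of_bool (Suc q * n \<le> m) * (1 - of_bool (n = 0))) =
        (\<Sum>q<m. of_bool (q < m div n) :: nat)" by (simp only:)
    also have "\<dots> = card ({..<m} \<inter> {q. q < m div n})" by simp
    also have "{..<m} \<inter> {q. q < m div n} = {..<m div n}"
      by (auto intro: less_le_trans[OF _ div_le_dividend])
    finally show ?thesis unfolding card_lessThan by (rule sym)
  qed simp
  moreover have "computable Es
      (\<lambda>e. \<Sum>q<a e. of_bool (Suc q * b e \<le> a e) * (1 - of_bool (b e = 0)))"
    by (intro computable_sum computable_mult computable_le computable_diff computable_eq
        computable_Suc computable_const computable_newest_var computable_weaken assms)
  ultimately show ?thesis by (simp only:)
qed

lemma computable_mod:
  assumes "computable Es a" "computable Es b"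
  shows "computable Es (\<lambda>e. a e mod b e)"
  unfolding modulo_nat_def by (intro computable_diff computable_mult computable_div assms)

section \<open>Computing with codes of pairs and lists\<close>

lemma computable_prod_encode:
  assumes "computable Es a" "computable Es b"
  shows "computable Es (\<lambda>e. prod_encode (a e, b e))"
  unfolding prod_encode_def triangle_def case_prod_conv
  by (intro computable_add computable_div computable_mult computable_Suc computable_const assms)

text \<open>Both components of a pair are at most its code, so decoding is a sum over all pairs in this range,
  in which the indicator of the given code selects a single term.\<close>

lemma computable_prod_decode:
  assumes "computable Es a"
  shows "computable Es (\<lambda>e. fst (prod_decode (a e)))" (is ?fst)
    and "computable Es (\<lambda>e. snd (prod_decode (a e)))" (is ?snd)
proof -
  let ?S = "\<lambda>h z. \<Sum>x<Suc z. \<Sum>y<Suc z. h x y * of_bool (prod_encode (x, y) = z)"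
  \<comment> \<open>One identity covers both projections, with \<open>h\<close> returning the first or the second component.\<close>
  have decode: "h (fst (prod_decode z)) (snd (prod_decode z)) = ?S h z"
    for h :: "nat \<Rightarrow> nat \<Rightarrow> nat" and z
  proof -
    obtain m n where z: "prod_decode z = (m, n)" by (cases "prod_decode z")
    then have z': "z = prod_encode (m, n)" by (metis prod_decode_inverse)
    have "m < Suc z" "n < Suc z" unfolding z' less_Suc_eq_le
      by (rule le_prod_encode_1 le_prod_encode_2)+
    have "?S h z = (\<Sum>x<Suc z. \<Sum>y<Suc z. if x = m \<and> y = n then h m n else 0)"
      by (intro sum.cong) (auto simp: z')
    also have "\<dots> = (\<Sum>x<Suc z. if x = m then h m n else 0)"
      using \<open>n < Suc z\<close> by (intro sum.cong) (auto simp del: sum.lessThan_Suc)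
    also have "\<dots> = h m n" using \<open>m < Suc z\<close> by (simp del: sum.lessThan_Suc)
    finally show ?thesis by (simp add: z)
  qed
  have "computable Es (\<lambda>e. ?S (\<lambda>x y. x) (a e))" "computable Es (\<lambda>e. ?S (\<lambda>x y. y) (a e))"
    by (intro computable_sum computable_mult computable_eq computable_prod_encode computable_Suc
        computable_newest_var computable_second_var computable_weaken computable_weaken2 assms)+
  then show ?fst ?snd unfolding decode[of "\<lambda>x y. x", symmetric] decode[of "\<lambda>x y. y", symmetric] .
qed

text \<open>The code of a nonempty list is the successor of the code of the pair of its head and tail. The code
  0 of the empty list behaves like a list whose tail is empty again, so dropping too many
  elements is harmless.\<close>

definition hd_code :: "nat \<Rightarrow> nat" where
  "hd_code c = fst (prod_decode (c - 1))"

definition tl_code :: "nat \<Rightarrow> nat" where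
  "tl_code c = snd (prod_decode (c - 1))"

definition drop_code :: "nat \<Rightarrow> nat \<Rightarrow> nat" where
  "drop_code i c = rec_nat c (\<lambda>_ d. tl_code d) i"

definition nth_code :: "nat \<Rightarrow> nat \<Rightarrow> nat" where
  "nth_code c i = hd_code (drop_code i c)"

text \<open>The length of a list is at most its code, which bounds the positions that need to be inspected.\<close>

definition length_code :: "nat \<Rightarrow> nat" where
  "length_code c = (\<Sum>i<c. 1 - of_bool (drop_code i c = 0))"

text \<open>Lists are built from the back, so step \<open>i\<close> adds the entry with index \<open>n - Suc i\<close>.\<close>

definition tabulate_code :: "(nat \<Rightarrow> nat) \<Rightarrow> nat \<Rightarrow> nat" where
  "tabulate_code f n = rec_nat 0 (\<lambda>i y. Suc (prod_encode (f (n - Suc i), y))) n"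

lemma tl_code_encode: "tl_code (list_encode xs) = list_encode (tl xs)"
proof (cases xs)
  case Nil
  have "prod_encode (0, 0) = 0" by (simp add: prod_encode_def)
  then have "prod_decode 0 = (0, 0)" by (metis prod_encode_inverse)
  with Nil show ?thesis by (simp add: tl_code_def)
qed (simp add: tl_code_def)

lemma drop_code_encode: "drop_code i (list_encode xs) = list_encode (drop i xs)"
  by (induction i) (auto simp: drop_code_def tl_code_encode drop_Suc tl_drop)

lemma nth_code_encode: "i < length xs \<Longrightarrow> nth_code (list_encode xs) i = xs ! i"
  by (simp add: nth_code_def drop_code_encode hd_code_def flip: Cons_nth_drop_Suc)

lemma length_le_list_encode: "length xs \<le> list_encode xs"
proof (induction xs)
  case (Cons x xs)
  then show ?case using le_prod_encode_2[of "list_encode xs" x] by simp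
qed simp

lemma length_code_encode: "length_code (list_encode xs) = length xs"
proof -
  let ?c = "list_encode xs"
  have nz: "list_encode ys = 0 \<longleftrightarrow> ys = []" for ys by (cases ys) auto
  have "length_code ?c = (\<Sum>i<?c. of_bool (i < length xs))"
    unfolding length_code_def by (intro sum.cong) (auto simp: drop_code_encode nz)
  also have "\<dots> = card ({..<?c} \<inter> {i. i < length xs})" by simp
  also have "{..<?c} \<inter> {i. i < length xs} = {..<length xs}"
    using length_le_list_encode[of xs] by auto
  finally show ?thesis by simp
qed

lemma tabulate_code_encode: "tabulate_code f n = list_encode (map f [0..<n])"
proof -
  have "rec_nat 0 (\<lambda>i y. Suc (prod_encode (f (n - Suc i), y))) k = list_encode (map f [n - k..<n])"
    if "k \<le> n" for k
    using that
  proof (induction k)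
    case (Suc k)
    then have "[n - Suc k..<n] = (n - Suc k) # [n - k..<n]"
      using upt_conv_Cons[of "n - Suc k" n] Suc_diff_Suc[of k n] by simp
    with Suc show ?case by simp
  qed simp
  from this[of n] show ?thesis by (simp add: tabulate_code_def)
qed

lemma computable_nth_code:
  assumes "computable Es c" "computable Es i"
  shows "computable Es (\<lambda>e. nth_code (c e) (i e))"
  unfolding nth_code_def hd_code_def drop_code_def tl_code_def
  by (intro computable_prod_decode computable_diff computable_rec_nat computable_const
      computable_second_var assms)

lemma computable_length_code:
  assumes "computable Es c"
  shows "computable Es (\<lambda>e. length_code (c e))"
  unfolding length_code_def drop_code_def tl_code_def
  by (intro computable_sum computable_diff computable_eq computable_prod_decode
      computable_rec_nat computable_const computable_newest_var computable_second_var computable_weaken assms)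

lemma computable_tabulate_code:
  assumes "computable Es n" "computable (push_var Es) (\<lambda>z. f (fst z) (snd z))"
  shows "computable Es (\<lambda>e. tabulate_code (\<lambda>i. f i e) (n e))"
proof -
  have "computable (push_var (push_var Es)) (\<lambda>z. n (snd (snd z)) - Suc (fst z))"
    by (intro computable_diff computable_Suc computable_newest_var computable_weaken2 assms)
  then have "computable (push_var (push_var Es))
      (\<lambda>z. f (n (snd (snd z)) - Suc (fst z)) (snd (snd z)))"
    by (rule computable_subst_bound[OF assms(2)])
  then show ?thesis
    unfolding tabulate_code_def
    by (intro computable_rec_nat computable_Suc computable_prod_encode computable_second_var
        computable_const assms)
qed

section \<open>The decision procedure\<close>

definition mult_vec_code :: "nat \<Rightarrow> nat \<Rightarrow> nat \<Rightarrow> nat" where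
  "mult_vec_code n A v = tabulate_code (\<lambda>i. \<Sum>j<n. nth_code (nth_code A i) j * nth_code v j) n"

definition orbit_code :: "nat \<Rightarrow> nat \<Rightarrow> nat \<Rightarrow> nat \<Rightarrow> nat \<Rightarrow> nat \<Rightarrow> nat" where
  "orbit_code n As m u w t =
    rec_nat u (\<lambda>i v. mult_vec_code n (nth_code As (w div m ^ i mod m)) v) t"

text \<open>The counterpart of \<open>repetition_within\<close> for codes, with the bound from
  \<open>has_bounded_trajectory_iff_repetition\<close>.\<close>

definition decide_code :: "nat \<Rightarrow> nat \<Rightarrow> nat \<Rightarrow> bool" where
  "decide_code n As us \<longleftrightarrow>
    (\<exists>w<length_code As ^ (3 ^ (n * n + 1)). \<exists>k<length_code us.
      \<exists>b<Suc (3 ^ (n * n + 1)). \<exists>a<b.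
        orbit_code n As (length_code As) (nth_code us k) w a =
        orbit_code n As (length_code As) (nth_code us k) w b)"

lemmas computable_intros = computable_rec_nat computable_Suc computable_const computable_add
  computable_mult computable_power computable_diff computable_sum computable_eq computable_Ex_less
  computable_div computable_mod computable_prod_decode computable_nth_code computable_length_code
  computable_tabulate_code

lemma computable_decide_code:
  "computable [\<lambda>c. c] (\<lambda>c. of_bool (decide_code (fst (prod_decode c))
     (fst (prod_decode (snd (prod_decode c)))) (snd (prod_decode (snd (prod_decode c))))))"
  unfolding decide_code_def orbit_code_def mult_vec_code_def
  by (intro computable_intros; rule computable_var; simp add: push_var_def)

lemma nth_code_vec:
  "v \<in> carrier_vec n \<Longrightarrow> j < n \<Longrightarrow> nth_code (code_vec v) j = nat (v $ j)"
  by (simp add: code_vec_def nth_code_encode)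

lemma nth_code_mat:
  "A \<in> carrier_mat n n \<Longrightarrow> i < n \<Longrightarrow> j < n \<Longrightarrow>
    nth_code (nth_code (code_mat A) i) j = nat (A $$ (i, j))"
  by (simp add: code_mat_def mat_to_list_def nth_code_encode)

lemma mult_vec_code_correct:
  assumes A: "A \<in> nonneg_int_mats n" and v: "v \<in> nonneg_int_vecs n"
  shows "mult_vec_code n (code_mat A) (code_vec v) = code_vec (A *\<^sub>v v)"
proof -
  have carr: "A \<in> carrier_mat n n" "v \<in> carrier_vec n"
    using A v by (auto simp: nonneg_int_mats_def nonneg_int_vecs_def)
  have entry: "(\<Sum>j<n. nth_code (nth_code (code_mat A) i) j * nth_code (code_vec v) j) =
      nat ((A *\<^sub>v v) $ i)" if i: "i < n" for i
  proof -
    have "(\<Sum>j<n. nth_code (nth_code (code_mat A) i) j * nth_code (code_vec v) j) =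
        (\<Sum>j<n. nat (A $$ (i, j)) * nat (v $ j))"
      using i by (intro sum.cong refl) (simp add: nth_code_mat[OF carr(1)] nth_code_vec[OF carr(2)])
    moreover have "int (\<Sum>j<n. nat (A $$ (i, j)) * nat (v $ j)) = (\<Sum>j<n. A $$ (i, j) * v $ j)"
      unfolding of_nat_sum using A v i
      by (intro sum.cong refl) (simp add: nonneg_int_mats_def nonneg_int_vecs_def)
    ultimately show ?thesis using mult_vec_entry[OF carr i] by (metis nat_int)
  qed
  have "dim_vec (A *\<^sub>v v) = n" using carr by simp
  then have "map nat (list_of_vec (A *\<^sub>v v)) =
      map (\<lambda>i. \<Sum>j<n. nth_code (nth_code (code_mat A) i) j * nth_code (code_vec v) j) [0..<n]"
    using entry by (intro nth_equalityI) (simp_all del: index_mult_mat_vec)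
  then show ?thesis by (simp add: mult_vec_code_def tabulate_code_encode code_vec_def)
qed

text \<open>Without matrices the index \<open>w div m ^ i mod m\<close> would be out of range, hence the last hypothesis.\<close>

lemma orbit_code_correct:
  assumes As: "set As \<subseteq> nonneg_int_mats n" and u: "u \<in> nonneg_int_vecs n" and m: "0 < length As"
  shows "orbit_code n (list_encode (map code_mat As)) (length As) (code_vec u) w t =
    code_vec (orbit As u (\<lambda>i. w div length As ^ i mod length As) t)"
proof (induction t)
  case (Suc t)
  let ?s = "\<lambda>i. w div length As ^ i mod length As"
  have s: "?s i < length As" for i using m by simp
  then have "As ! ?s t \<in> nonneg_int_mats n" using As by (meson nth_mem subsetD)
  moreover have "orbit As u ?s t \<in> nonneg_int_vecs n" using orbit_nonneg[OF As u, of t ?s] s by blast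
  moreover have "nth_code (list_encode (map code_mat As)) (?s t) = code_mat (As ! ?s t)"
    using s[of t] by (simp add: nth_code_encode)
  ultimately show ?case using Suc mult_vec_code_correct by (simp add: orbit_code_def)
qed (simp add: orbit_code_def)

lemma decide_code_correct:
  assumes "(n, As, us) \<in> instances"
  shows "decide_code n (list_encode (map code_mat As)) (list_encode (map code_vec us)) \<longleftrightarrow>
    repetition_within (3 ^ (n * n + 1)) As us"
proof -
  let ?As = "list_encode (map code_mat As)" and ?us = "list_encode (map code_vec us)"
  let ?s = "\<lambda>w i. w div length As ^ i mod length As"
  have inst: "set As \<subseteq> nonneg_int_mats n" "set us \<subseteq> nonneg_int_vecs n"
    using assms by (auto simp: instances_def)
  have eq: "orbit_code n ?As (length As) (nth_code ?us k) w a =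
      orbit_code n ?As (length As) (nth_code ?us k) w b \<longleftrightarrow>
      orbit As (us ! k) (?s w) a = orbit As (us ! k) (?s w) b"
    if w: "w < length As ^ 3 ^ (n * n + 1)" and k: "k < length us" for w k a b
  proof -
    have m: "0 < length As"
    proof (rule ccontr)
      assume "\<not> 0 < length As"
      with w show False by (simp add: power_0_left)
    qed
    have u: "us ! k \<in> nonneg_int_vecs n" using inst(2) k by (meson nth_mem subsetD)
    have "nth_code ?us k = code_vec (us ! k)" using k by (simp add: nth_code_encode)
    moreover have "orbit As (us ! k) (?s w) t \<in> nonneg_int_vecs n" for t
      using m by (intro orbit_nonneg[OF inst(1) u]) simp
    ultimately show ?thesis
      using orbit_code_correct[OF inst(1) u m] inj_on_eq_iff[OF inj_on_code_vec[of n]] by simp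
  qed
  show ?thesis
    unfolding decide_code_def repetition_within_def length_code_encode length_map
    by (intro ex_cong1 conj_cong refl eq)
qed

theorem theorem17:
  shows "decidable code_inst instances has_bounded_trajectory"
proof -
  obtain p where p: "\<And>c. halts_with p [c] (of_bool (decide_code (fst (prod_decode c))
      (fst (prod_decode (snd (prod_decode c)))) (snd (prod_decode (snd (prod_decode c))))))"
    using computable_decide_code unfolding computable_def by auto
  have "halts_with p [code_inst x] (if has_bounded_trajectory x then 1 else 0)"
    if "x \<in> instances" for x
  proof -
    obtain n As us where x: "x = (n, As, us)" by (cases x)
    have "has_bounded_trajectory x \<longleftrightarrow>
        decide_code n (list_encode (map code_mat As)) (list_encode (map code_vec us))"
      using that decide_code_correct has_bounded_trajectory_iff_repetition unfolding x by metis
    with p[of "code_inst x"] show ?thesis by (simp add: x of_bool_def)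
  qed
  then show ?thesis unfolding decidable_def by blast
qed

end
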